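(* Let $G$ be a group, let $\mathcal{N}$ be a non-empty set of normal subgroups of $G$, and let $\mathcal{H}$ be a URS of $G$ that is $\mathcal{N}$-finitary. Then the map $\mathcal{H}\to\mathrm{Sub}(G)$, $H\mapsto \mathrm{cl}_{\mathcal{N}}(H)$, is upper semi-continuous.
   Context: $\mathrm{Sub}(G)$ is the set of subgroups of $G$ with the topology induced from the product topology on $\{0,1\}^G$; $G$ acts on it by conjugation. A URS of $G$ is a non-empty closed $G$-invariant minimal subset of $\mathrm{Sub}(G)$. For a subgroup $L$, $L^G$ denotes the set of $G$-conjugates of $L$. A URS $\mathcal{H}$ is $\mathcal{N}$-finitary if $(HN)^G$ is finite for every $H\in\mathcal{H}$ and $N\in\mathcal{N}$. For a subgroup $H$ of $G$, $\mathrm{cl}_{\mathcal{N}}(H):=\bigcap_{N\in\mathcal{N}}HN$. A map $\varphi:X\to\mathrm{Sub}(G)$ is upper semi-continuous if for every finite subset $K$ of $G$, the set $\{x\in X:\varphi(x)\cap K=\emptyset\}$ is open in $X$. *)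

theory Defs
  imports "HOL-Analysis.Analysis" "HOL-Algebra.Coset"
begin

definition Sub :: "('a, 'b) monoid_scheme \<Rightarrow> 'a set set" where
  "Sub G = {H. subgroup H G}"

text \<open>The space \<open>{0,1}\<^sup>G\<close> is rendered as the product over \<^term>\<open>carrier G\<close> of copies of
  the discrete two-point space \<^typ>\<open>bool\<close>; a subgroup is identified with its indicator function.\<close>

definition Sub_topology :: "('a, 'b) monoid_scheme \<Rightarrow> 'a set topology" where
  "Sub_topology G =
     pullback_topology (Sub G) (\<lambda>H. \<lambda>g\<in>carrier G. g \<in> H)
       (product_topology (\<lambda>_. discrete_topology (UNIV :: bool set)) (carrier G))"

lemma topspace_Sub_topology [simp]: "topspace (Sub_topology G) = Sub G"
  by (auto simp: Sub_topology_def topspace_pullback_topology)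

definition conjugate :: "('a, 'b) monoid_scheme \<Rightarrow> 'a \<Rightarrow> 'a set \<Rightarrow> 'a set" where
  "conjugate G g H = g <#\<^bsub>G\<^esub> H #>\<^bsub>G\<^esub> inv\<^bsub>G\<^esub> g"

definition conjugates :: "('a, 'b) monoid_scheme \<Rightarrow> 'a set \<Rightarrow> 'a set set" where
  "conjugates G L = (\<lambda>g. conjugate G g L) ` carrier G"

definition closed_invariant :: "('a, 'b) monoid_scheme \<Rightarrow> 'a set set \<Rightarrow> bool" where
  "closed_invariant G \<H> \<longleftrightarrow>
     closedin (Sub_topology G) \<H> \<and> (\<forall>g\<in>carrier G. \<forall>H\<in>\<H>. conjugate G g H \<in> \<H>)"

definition URS :: "('a, 'b) monoid_scheme \<Rightarrow> 'a set set \<Rightarrow> bool" where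
  "URS G \<H> \<longleftrightarrow> \<H> \<noteq> {} \<and> closed_invariant G \<H> \<and>
     (\<forall>\<Y>. \<Y> \<subseteq> \<H> \<and> \<Y> \<noteq> {} \<and> closed_invariant G \<Y> \<longrightarrow> \<Y> = \<H>)"

definition finitary :: "('a, 'b) monoid_scheme \<Rightarrow> 'a set set \<Rightarrow> 'a set set \<Rightarrow> bool" where
  "finitary G \<N> \<H> \<longleftrightarrow> (\<forall>H\<in>\<H>. \<forall>N\<in>\<N>. finite (conjugates G (H <#>\<^bsub>G\<^esub> N)))"

definition cl :: "('a, 'b) monoid_scheme \<Rightarrow> 'a set set \<Rightarrow> 'a set \<Rightarrow> 'a set" where
  "cl G \<N> H = (\<Inter>N\<in>\<N>. H <#>\<^bsub>G\<^esub> N)"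

text \<open>The requirement that the map takes values in \<^term>\<open>Sub G\<close> is part of the definition.\<close>

definition upper_semicontinuous ::
    "('a, 'b) monoid_scheme \<Rightarrow> 'x topology \<Rightarrow> ('x \<Rightarrow> 'a set) \<Rightarrow> bool" where
  "upper_semicontinuous G X \<phi> \<longleftrightarrow>
     \<phi> \<in> topspace X \<rightarrow> Sub G \<and>
     (\<forall>K. finite K \<and> K \<subseteq> carrier G \<longrightarrow> openin X {x \<in> topspace X. \<phi> x \<inter> K = {}})"

end

theory Submission
  imports Defs "HOL-Algebra.Zassenhaus"
begin

text \<open>The idea is that, for a single \<open>N \<in> \<N>\<close>, the subgroup \<open>HN\<close> cannot grow when
  \<open>H \<in> \<H>\<close> moves slightly: every \<open>H\<^sub>0 \<in> \<H>\<close> has a neighbourhood in \<open>\<H>\<close> on which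
  \<open>HN \<subseteq> H\<^sub>0N\<close> (lemma \<open>locally_product_subset\<close>).
  Put \<open>L = H\<^sub>0N\<close>, which has finitely many conjugates. The members of \<open>\<H>\<close> lying in some conjugate
  of \<open>L\<close> form a closed set because only finitely many conjugates occur; this set is invariant
  and contains \<open>H\<^sub>0\<close>, so by minimality it is all of \<open>\<H>\<close> (lemma \<open>URS_subset_some_conjugate\<close>).
  Whether \<open>H\<close> lies in a given set is a closed condition on \<open>H\<close>, so an \<open>H\<close>
  close to \<open>H\<^sub>0\<close> avoids the finitely many conjugates of \<open>L\<close> that do not contain \<open>H\<^sub>0\<close>.
  The conjugate that does contain \<open>H\<close> therefore contains \<open>H\<^sub>0\<close>, hence \<open>L\<close>; and a subgroup with
  finitely many conjugates is not properly contained in one of them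
  (lemma \<open>conjugate_eq_of_subset\<close>). So \<open>H \<subseteq> L\<close> and \<open>HN \<subseteq> L\<close>.

  Consequently \<open>{H \<in> \<H>. k \<notin> HN}\<close> is open for each \<open>k\<close> and \<open>N\<close>, and the set of \<open>H\<close> with
  \<open>cl\<^sub>\<N>(H) \<inter> K = \<emptyset>\<close> is the finite intersection over \<open>k \<in> K\<close> of the unions over \<open>N \<in> \<N>\<close>
  of these sets.\<close>

section \<open>Conjugation of subsets\<close>

lemma conjugate_eq_image: "conjugate G g H = (\<lambda>h. g \<otimes>\<^bsub>G\<^esub> h \<otimes>\<^bsub>G\<^esub> inv\<^bsub>G\<^esub> g) ` H"
  by (auto simp: conjugate_def l_coset_def r_coset_def)

lemma conjugate_mono: "A \<subseteq> B \<Longrightarrow> conjugate G g A \<subseteq> conjugate G g B"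
  by (auto simp: conjugate_eq_image)

context group
begin

lemma conjugate_closed: "g \<in> carrier G \<Longrightarrow> H \<subseteq> carrier G \<Longrightarrow> conjugate G g H \<subseteq> carrier G"
  by (auto simp: conjugate_eq_image)

lemma conjugate_mult:
  assumes "g \<in> carrier G" "h \<in> carrier G" "H \<subseteq> carrier G"
  shows "conjugate G g (conjugate G h H) = conjugate G (g \<otimes> h) H"
proof -
  have "g \<otimes> (h \<otimes> x \<otimes> inv h) \<otimes> inv g = g \<otimes> h \<otimes> x \<otimes> inv (g \<otimes> h)" if "x \<in> H" for x
    using assms that by (auto simp: inv_mult_group m_assoc subset_iff)
  then show ?thesis
    by (simp add: conjugate_eq_image image_image)
qed

lemma conjugate_one: "H \<subseteq> carrier G \<Longrightarrow> conjugate G \<one> H = H"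
  by (force simp: conjugate_eq_image subset_iff)

lemma self_in_conjugates: "H \<subseteq> carrier G \<Longrightarrow> H \<in> conjugates G H"
  unfolding conjugates_def by (metis conjugate_one imageI one_closed)

lemma conjugate_in_conjugates:
  assumes "g \<in> carrier G" "H \<subseteq> carrier G" "M \<in> conjugates G H"
  shows "conjugate G g M \<in> conjugates G H"
  using assms by (auto simp: conjugates_def conjugate_mult)

lemma conjugates_subset_carrier:
  "H \<subseteq> carrier G \<Longrightarrow> M \<in> conjugates G H \<Longrightarrow> M \<subseteq> carrier G"
  using conjugate_closed by (auto simp: conjugates_def)

text \<open>Conjugation permutes the conjugates of \<open>L\<close> and preserves inclusion, so \<open>L\<close> and each of its
  conjugates \<open>M\<close> contain equally many conjugates of \<open>L\<close>. If \<open>L \<subseteq> M\<close> and these numbers are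
  finite, then \<open>L\<close> and \<open>M\<close> contain the same conjugates, in particular \<open>M \<subseteq> L\<close>.\<close>

lemma conjugate_eq_of_subset:
  assumes L: "L \<subseteq> carrier G" and fin: "finite (conjugates G L)"
    and M: "M \<in> conjugates G L" and sub: "L \<subseteq> M"
  shows "M = L"
proof -
  define below where "below A = {F \<in> conjugates G L. F \<subseteq> A}" for A
  obtain x where x: "x \<in> carrier G" and Mx: "M = conjugate G x L"
    using M by (auto simp: conjugates_def)
  have finb: "finite (below A)" for A
    using fin by (simp add: below_def)
  have "below M \<subseteq> conjugate G x ` below L"
  proof
    fix F assume "F \<in> below M"
    then have F: "F \<in> conjugates G L" "F \<subseteq> M" by (auto simp: below_def)
    have FG: "F \<subseteq> carrier G"
      using F(1) L conjugates_subset_carrier by blast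
    have "conjugate G (inv x) F \<subseteq> conjugate G (inv x) M"
      using F(2) by (rule conjugate_mono)
    also have "\<dots> = L"
      using x L by (simp add: Mx conjugate_mult conjugate_one)
    finally have "conjugate G (inv x) F \<in> below L"
      using x L F(1) by (simp add: below_def conjugate_in_conjugates)
    moreover have "F = conjugate G x (conjugate G (inv x) F)"
      using x FG by (simp add: conjugate_mult conjugate_one)
    ultimately show "F \<in> conjugate G x ` below L" by blast
  qed
  then have "card (below M) \<le> card (below L)"
    using finb surj_card_le by blast
  moreover have "below L \<subseteq> below M"
    using sub by (auto simp: below_def)
  ultimately have "below L = below M"
    using finb card_seteq by blast
  moreover have "M \<in> below M"
    using M by (simp add: below_def)
  ultimately show ?thesis
    using sub by (auto simp: below_def)
qed

end

section \<open>Closed conditions on subgroups\<close>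

lemma continuous_map_membership:
  assumes "g \<in> carrier G"
  shows "continuous_map (Sub_topology G) (discrete_topology UNIV) (\<lambda>H. g \<in> H)"
proof -
  have "continuous_map (Sub_topology G) (discrete_topology UNIV)
          ((\<lambda>f. f g) \<circ> (\<lambda>H. \<lambda>g\<in>carrier G. g \<in> H))"
    unfolding Sub_topology_def using assms
    by (intro continuous_map_pullback continuous_map_product_projection)
  then show ?thesis
    using assms by (simp add: comp_def)
qed

lemma closedin_subgroups_within: "closedin (Sub_topology G) {H \<in> Sub G. H \<subseteq> M}"
proof -
  have "closedin (Sub_topology G) {H \<in> Sub G. g \<notin> H}" if "g \<in> carrier G" for g
    using closedin_continuous_map_preimage[OF continuous_map_membership[OF that], of "{False}"]
    by simp
  moreover have "{H \<in> Sub G. H \<subseteq> M} =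
      Sub G \<inter> (\<Inter>g \<in> carrier G - M. {H \<in> Sub G. g \<notin> H})"
    by (auto simp: Sub_def dest: subgroup.mem_carrier)
  moreover have "closedin (Sub_topology G) (Sub G)"
    using closedin_topspace[of "Sub_topology G"] by simp
  ultimately show ?thesis
    by (cases "carrier G - M = {}") (auto intro!: closedin_Int closedin_Inter)
qed

section \<open>Products with a normal subgroup along a finitary URS\<close>

lemma URS_subset_Sub: "URS G \<H> \<Longrightarrow> \<H> \<subseteq> Sub G"
  unfolding URS_def closed_invariant_def using closedin_subset by fastforce

text \<open>Minimality is used here: finiteness of the conjugacy class makes the set of members of
  \<open>\<H>\<close> lying in some conjugate of \<open>L\<close> closed, and it is clearly invariant.\<close>

lemma (in group) URS_subset_some_conjugate:
  assumes urs: "URS G \<H>" and L: "L \<subseteq> carrier G" and fin: "finite (conjugates G L)"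
    and H0: "H\<^sub>0 \<in> \<H>" "H\<^sub>0 \<subseteq> L" and H: "H \<in> \<H>"
  shows "\<exists>M \<in> conjugates G L. H \<subseteq> M"
proof -
  define \<Y> where "\<Y> = {H \<in> \<H>. \<exists>M \<in> conjugates G L. H \<subseteq> M}"
  have inv: "closed_invariant G \<H>"
    using urs by (simp add: URS_def)
  have "\<Y> = \<H> \<inter> (\<Union>M \<in> conjugates G L. {H \<in> Sub G. H \<subseteq> M})"
    using URS_subset_Sub[OF urs] by (auto simp: \<Y>_def)
  moreover have "closedin (Sub_topology G) \<H>"
    using inv by (simp add: closed_invariant_def)
  ultimately have "closedin (Sub_topology G) \<Y>"
    using fin by (auto intro!: closedin_Int closedin_Union closedin_subgroups_within)
  moreover have "conjugate G g A \<in> \<Y>" if g: "g \<in> carrier G" and A: "A \<in> \<Y>" for g A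
  proof -
    obtain M where M: "M \<in> conjugates G L" "A \<subseteq> M" and AH: "A \<in> \<H>"
      using A by (auto simp: \<Y>_def)
    have "conjugate G g M \<in> conjugates G L"
      using g L M(1) by (rule conjugate_in_conjugates)
    moreover have "conjugate G g A \<subseteq> conjugate G g M"
      using M(2) by (rule conjugate_mono)
    moreover have "conjugate G g A \<in> \<H>"
      using inv g AH by (simp add: closed_invariant_def)
    ultimately show ?thesis
      by (auto simp: \<Y>_def)
  qed
  ultimately have "closed_invariant G \<Y>"
    by (simp add: closed_invariant_def)
  moreover have "H\<^sub>0 \<in> \<Y>"
    using H0 self_in_conjugates[OF L] by (auto simp: \<Y>_def)
  moreover have "\<Y> \<subseteq> \<H>"
    by (auto simp: \<Y>_def)
  ultimately have "\<Y> = \<H>"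
    using urs unfolding URS_def by blast
  with H show ?thesis
    by (auto simp: \<Y>_def)
qed

lemma (in group) subgroup_mult_normal:
  assumes "subgroup H G" "N \<lhd> G"
  shows "subgroup (H <#> N) G" "H \<subseteq> H <#> N" "N \<subseteq> H <#> N"
proof -
  have N: "subgroup N G"
    using assms(2) by (rule normal_imp_subgroup)
  show "subgroup (H <#> N) G"
    using mult_norm_subgroup[OF assms(2,1)] by (simp add: commut_normal[OF assms])
  show "H \<subseteq> H <#> N"
    using assms(1) subgroup.one_closed[OF N] subgroup.subset
    by (force simp: set_mult_def)
  show "N \<subseteq> H <#> N"
    using subgroup.one_closed[OF assms(1)] subgroup.subset[OF N]
    by (force simp: set_mult_def)
qed

lemma (in group) mult_subset_subgroup:
  "subgroup L G \<Longrightarrow> A \<subseteq> L \<Longrightarrow> B \<subseteq> L \<Longrightarrow> A <#> B \<subseteq> L"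
  by (auto simp: set_mult_def intro: subgroup.m_closed)

lemma (in group) normal_subset_conjugate:
  assumes N: "N \<lhd> G" and L: "L \<subseteq> carrier G" "N \<subseteq> L" and M: "M \<in> conjugates G L"
  shows "N \<subseteq> M"
proof -
  obtain x where x: "x \<in> carrier G" and Mx: "M = conjugate G x L"
    using M by (auto simp: conjugates_def)
  have NG: "N \<subseteq> carrier G"
    using L by blast
  have "conjugate G (inv x) N \<subseteq> N"
    using normal.inv_op_closed1[OF N] x by (auto simp: conjugate_eq_image)
  then have "conjugate G x (conjugate G (inv x) N) \<subseteq> conjugate G x L"
    using L(2) by (intro conjugate_mono) blast
  then show ?thesis
    using x NG by (simp add: Mx conjugate_mult conjugate_one)
qed

lemma (in group) subgroup_conjugates:
  assumes L: "subgroup L G" and M: "M \<in> conjugates G L"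
  shows "subgroup M G"
proof -
  obtain x where x: "x \<in> carrier G" and Mx: "M = conjugate G x L"
    using M by (auto simp: conjugates_def)
  have "x \<otimes> (a \<otimes> b) \<otimes> inv x = x \<otimes> a \<otimes> inv x \<otimes> (x \<otimes> b \<otimes> inv x)"
    if "a \<in> carrier G" "b \<in> carrier G" for a b
  proof -
    have "inv x \<otimes> (x \<otimes> (b \<otimes> inv x)) = b \<otimes> inv x"
      using x that by (simp flip: m_assoc)
    then show ?thesis
      using x that by (simp add: m_assoc)
  qed
  then have "group_hom G G (\<lambda>h. x \<otimes> h \<otimes> inv x)"
    using x by unfold_locales (auto simp: hom_def)
  from group_hom.subgroup_img_is_subgroup[OF this L] show ?thesis
    by (simp add: Mx conjugate_eq_image)
qed

text \<open>Near \<open>H\<^sub>0\<close>, a member \<open>H\<close> of \<open>\<H>\<close> lies in no conjugate of \<open>H\<^sub>0N\<close> except those containing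
  \<open>H\<^sub>0\<close>, and the only such conjugate is \<open>H\<^sub>0N\<close> itself; but it lies in one of them.\<close>

lemma (in group) locally_product_subset:
  assumes urs: "URS G \<H>" and N: "N \<lhd> G" and H0: "H\<^sub>0 \<in> \<H>"
    and fin: "finite (conjugates G (H\<^sub>0 <#> N))"
  obtains T where "openin (subtopology (Sub_topology G) \<H>) T" "H\<^sub>0 \<in> T"
    "\<And>H. H \<in> T \<Longrightarrow> H <#> N \<subseteq> H\<^sub>0 <#> N"
proof -
  define L where "L = H\<^sub>0 <#> N"
  define bad where "bad = {M \<in> conjugates G L. \<not> H\<^sub>0 \<subseteq> M}"
  define T where "T = \<H> - (\<Union>M \<in> bad. {H \<in> Sub G. H \<subseteq> M})"
  have HG: "\<H> \<subseteq> Sub G"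
    using urs by (rule URS_subset_Sub)
  have "subgroup H\<^sub>0 G"
    using H0 HG by (auto simp: Sub_def)
  note L = subgroup_mult_normal[OF this N, folded L_def]
  have LG: "L \<subseteq> carrier G"
    using L(1) by (rule subgroup.subset)
  have finL: "finite (conjugates G L)"
    using fin by (simp add: L_def)
  have "finite bad"
    using finL by (simp add: bad_def)
  then have "closedin (Sub_topology G) (\<Union>M \<in> bad. {H \<in> Sub G. H \<subseteq> M})"
    by (auto intro!: closedin_Union closedin_subgroups_within)
  then have "openin (Sub_topology G) (Sub G - (\<Union>M \<in> bad. {H \<in> Sub G. H \<subseteq> M}))"
    using openin_diff[OF openin_topspace] by fastforce
  moreover have "T = \<H> \<inter> (Sub G - (\<Union>M \<in> bad. {H \<in> Sub G. H \<subseteq> M}))"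
    using HG by (auto simp: T_def)
  ultimately have "openin (subtopology (Sub_topology G) \<H>) T"
    by (auto simp: openin_subtopology_Int2)
  moreover have "H\<^sub>0 \<in> T"
    using H0 by (auto simp: T_def bad_def)
  moreover have "H <#> N \<subseteq> H\<^sub>0 <#> N" if H: "H \<in> T" for H
  proof -
    have HH: "H \<in> \<H>"
      using H by (simp add: T_def)
    obtain M where M: "M \<in> conjugates G L" "H \<subseteq> M"
      using URS_subset_some_conjugate[OF urs LG finL H0 L(2) HH] by blast
    have "H\<^sub>0 \<subseteq> M"
      using H M HG HH by (auto simp: T_def bad_def)
    moreover have "N \<subseteq> M"
      using normal_subset_conjugate[OF N LG L(3) M(1)] .
    ultimately have "L \<subseteq> M"
      unfolding L_def using subgroup_conjugates[OF L(1) M(1)] by (intro mult_subset_subgroup)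
    then have "M = L"
      using conjugate_eq_of_subset[OF LG finL M(1)] by simp
    then have "H <#> N \<subseteq> L"
      using M(2) L by (intro mult_subset_subgroup) auto
    then show ?thesis
      by (simp add: L_def)
  qed
  ultimately show thesis
    by (rule that)
qed

theorem proposition3p4:
  fixes G :: "('a, 'b) monoid_scheme"
    and \<N> \<H> :: "'a set set"
  assumes "group G"
    and "\<N> \<noteq> {}"
    and "\<And>N. N \<in> \<N> \<Longrightarrow> N \<lhd> G"
    and "URS G \<H>"
    and "finitary G \<N> \<H>"
  shows "upper_semicontinuous G (subtopology (Sub_topology G) \<H>) (cl G \<N>)"
proof -
  interpret group G by fact
  let ?X = "subtopology (Sub_topology G) \<H>"
  have HG: "\<H> \<subseteq> Sub G"
    using assms(4) by (rule URS_subset_Sub)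
  then have top: "topspace ?X = \<H>"
    by auto
  have "cl G \<N> H \<in> Sub G" if "H \<in> \<H>" for H
  proof -
    have "subgroup (H <#>\<^bsub>G\<^esub> N) G" if "N \<in> \<N>" for N
      using \<open>H \<in> \<H>\<close> HG assms(3)[OF that] by (auto simp: Sub_def intro: subgroup_mult_normal(1))
    then show ?thesis
      using assms(2) by (auto simp: cl_def Sub_def intro!: subgroups_Inter)
  qed
  moreover have "openin ?X {H \<in> \<H>. cl G \<N> H \<inter> K = {}}" if "finite K" for K
  proof -
    have op: "openin ?X {H \<in> \<H>. k \<notin> H <#>\<^bsub>G\<^esub> N}" if N: "N \<in> \<N>" for k N
    proof (subst openin_subopen, intro ballI)
      fix H0 assume "H0 \<in> {H \<in> \<H>. k \<notin> H <#>\<^bsub>G\<^esub> N}"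
      then have H0: "H0 \<in> \<H>" "k \<notin> H0 <#>\<^bsub>G\<^esub> N" by auto
      have "finite (conjugates G (H0 <#>\<^bsub>G\<^esub> N))"
        using assms(5) H0(1) N by (simp add: finitary_def)
      then obtain T where T: "openin ?X T" "H0 \<in> T"
          "\<And>H. H \<in> T \<Longrightarrow> H <#>\<^bsub>G\<^esub> N \<subseteq> H0 <#>\<^bsub>G\<^esub> N"
        using locally_product_subset[OF assms(4) assms(3)[OF N] H0(1)] by blast
      have "T \<subseteq> {H \<in> \<H>. k \<notin> H <#>\<^bsub>G\<^esub> N}"
        using T(3) H0(2) openin_subset[OF T(1)] top by blast
      with T(1,2) show "\<exists>T. openin ?X T \<and> H0 \<in> T \<and> T \<subseteq> {H \<in> \<H>. k \<notin> H <#>\<^bsub>G\<^esub> N}"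
        by blast
    qed
    have "openin ?X (\<Union>N\<in>\<N>. {H \<in> \<H>. k \<notin> H <#>\<^bsub>G\<^esub> N})" for k
      using op by blast
    moreover have "openin ?X \<H>"
      using openin_topspace[of ?X] top by simp
    \<comment> \<open>The factor \<open>\<H>\<close> gives the intersection its right value when \<open>K\<close> is empty.\<close>
    moreover have "{H \<in> \<H>. cl G \<N> H \<inter> K = {}} =
        \<H> \<inter> (\<Inter>k\<in>K. \<Union>N\<in>\<N>. {H \<in> \<H>. k \<notin> H <#>\<^bsub>G\<^esub> N})"
      by (auto simp: cl_def)
    ultimately show ?thesis
      using that by (cases "K = {}") (auto intro!: openin_Int openin_Inter)
  qed
  ultimately show ?thesis
    unfolding upper_semicontinuous_def top by auto
qed

end
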